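(* Let $f: \mathbb{R}^n \to \mathbb{R}$ be convex. Then $f$ is globally Lipschitz continuous if and only if $$\ell:= \limsup_{\|x\| \to +\infty} \dfrac{|f(x)|}{\|x\|}<+\infty.$$ In this case, $\ell$ is also the global Lipschitz modulus of $f$.
   Context: $\mathbb{R}^n$ ($n$ a positive integer) is the standard Euclidean space with Euclidean norm $\|\cdot\|$. A function $f:\mathbb{R}^n\to\mathbb{R}$ is convex if $f(\lambda x+(1-\lambda)y)\le \lambda f(x)+(1-\lambda)f(y)$ for all $x,y\in\mathbb{R}^n$ and all $\lambda\in[0,1]$. A function $f$ is globally Lipschitz continuous if there exists $L\ge 0$ such that $|f(x)-f(y)|\le L\|x-y\|$ for all $x,y\in\mathbb{R}^n$; the infimum of all such $L$ is called the global Lipschitz modulus of $f$ (the Lipschitz modulus of $f$ on $\mathbb{R}^n$). *)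

theory Defs
  imports "HOL-Analysis.Analysis"
begin

(* For f that is not Lipschitz the set is empty and the value is meaningless. *)
definition global_lipschitz_modulus :: "('a::metric_space \<Rightarrow> 'b::metric_space) \<Rightarrow> real"
  where "global_lipschitz_modulus f = Inf {L. L-lipschitz_on UNIV f}"

end

theory Submission
  imports Defs
begin

text \<open>Along a ray starting at \<open>x\<close>, the difference quotients of a convex function are
  nondecreasing in the length of the step, so each of them is bounded by their limit at infinity;
  and what the function does at infinity is all that the upper limit \<open>l\<close> of \<open>\<bar>f x\<bar> / \<parallel>x\<parallel>\<close> sees.  Hence every
  real number \<open>M > l\<close> is a Lipschitz constant (\<open>lipschitz_on_if_convex_linear_growth\<close>).
  Conversely, every Lipschitz constant \<open>L\<close> satisfies \<open>l \<le> L\<close>, because the value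
  \<open>f 0\<close> is negligible compared with \<open>\<parallel>x\<parallel>\<close> (\<open>Limsup_norm_quotient_le_lipschitz\<close>).  So the set of
  Lipschitz constants lies above \<open>l\<close> and contains everything strictly above \<open>l\<close>; its infimum
  is \<open>l\<close>, and it is nonempty exactly when \<open>l < \<infinity>\<close>.\<close>

lemma Limsup_norm_quotient_le_lipschitz:
  fixes f :: "'a::{real_normed_vector,perfect_space} \<Rightarrow> real"
  assumes "L-lipschitz_on UNIV f"
  shows "Limsup at_infinity (\<lambda>x. ereal (\<bar>f x\<bar> / norm x)) \<le> ereal L"
proof -
  have nz: "eventually (\<lambda>x::'a. norm x > 0) at_infinity"
    by (auto simp: eventually_at_infinity intro: exI[of _ 1])
  have le: "\<bar>f x\<bar> / norm x \<le> \<bar>f 0\<bar> / norm x + L" if "norm x > 0" for x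
  proof -
    have "\<bar>f x - f 0\<bar> \<le> L * norm x"
      using lipschitz_onD[OF assms, of x 0] by (simp add: dist_norm)
    then have "\<bar>f x\<bar> \<le> \<bar>f 0\<bar> + L * norm x"
      by linarith
    with that show ?thesis
      by (simp add: field_simps)
  qed
  have "Limsup at_infinity (\<lambda>x. ereal (\<bar>f x\<bar> / norm x))
      \<le> Limsup at_infinity (\<lambda>x::'a. ereal (\<bar>f 0\<bar> / norm x + L))"
    by (intro Limsup_mono eventually_mono[OF nz]) (simp add: le)
  also
  have "((\<lambda>x. \<bar>f 0\<bar> / norm (x::'a) + L) \<longlongrightarrow> 0 + L) at_infinity"
    by (intro tendsto_intros tendsto_divide_0[OF tendsto_const] filterlim_at_top_imp_at_infinity
        filterlim_norm_at_top)
  then have "Limsup at_infinity (\<lambda>x::'a. ereal (\<bar>f 0\<bar> / norm x + L)) = ereal L"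
    by (intro lim_imp_Limsup) (auto simp: trivial_limit_at_infinity)
  finally show ?thesis .
qed

text \<open>With \<open>u = y - x\<close> and \<open>t \<ge> 1\<close>, the point \<open>y\<close> lies on the segment from \<open>x\<close> to \<open>x + t u\<close>, so
  \<open>f y - f x \<le> (f (x + t u) - f x) / t \<le> M \<parallel>u\<parallel> + (M \<parallel>x\<parallel> - f x) / t\<close> for all large \<open>t\<close>.
  The last summand vanishes as \<open>t\<close> grows.\<close>

lemma convex_linear_growth_increment_le:
  fixes f :: "'a::real_normed_vector \<Rightarrow> real"
  assumes convex: "convex_on UNIV f" and "M \<ge> 0"
    and growth: "eventually (\<lambda>x. f x \<le> M * norm x) at_infinity"
  shows "f y - f x \<le> M * norm (y - x)"
proof (cases "y = x")
  case False
  define u where "u = y - x"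
  have "norm u > 0"
    using False by (simp add: u_def)
  obtain B where B: "\<And>z. norm z \<ge> B \<Longrightarrow> f z \<le> M * norm z"
    using growth by (auto simp: eventually_at_infinity)
  have bound: "f y - f x \<le> M * norm u + (M * norm x - f x) / t"
    if "t \<ge> max 1 ((B + norm x) / norm u)" for t
  proof -
    have t: "t \<ge> 1" "B + norm x \<le> t * norm u"
      using that \<open>norm u > 0\<close> by (auto simp: field_simps)
    have "norm (t *\<^sub>R u) \<le> norm (x + t *\<^sub>R u) + norm x"
      by (metis add_diff_cancel_left' norm_triangle_ineq4)
    then have "norm (x + t *\<^sub>R u) \<ge> B"
      using t by simp
    then have "f (x + t *\<^sub>R u) \<le> M * norm (x + t *\<^sub>R u)"
      by (rule B)
    also have "\<dots> \<le> M * (norm x + t * norm u)"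
      using norm_triangle_ineq[of x "t *\<^sub>R u"] t \<open>M \<ge> 0\<close> by (intro mult_left_mono) auto
    finally have far: "f (x + t *\<^sub>R u) \<le> M * (norm x + t * norm u)" .
    have "y = (1 - 1/t) *\<^sub>R x + (1/t) *\<^sub>R (x + t *\<^sub>R u)"
      using t by (simp add: u_def algebra_simps)
    then have "f y \<le> (1 - 1/t) * f x + (1/t) * f (x + t *\<^sub>R u)"
      using convex_onD[OF convex, of "1/t" x "x + t *\<^sub>R u"] t by simp
    also have "\<dots> \<le> (1 - 1/t) * f x + (1/t) * (M * (norm x + t * norm u))"
      using far t by (intro add_left_mono mult_left_mono) auto
    also have "\<dots> = f x + M * norm u + (M * norm x - f x) / t"
      using t by (simp add: add_divide_distrib diff_divide_distrib distrib_left left_diff_distrib)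
    finally show ?thesis
      by simp
  qed
  have "((\<lambda>t. M * norm u + (M * norm x - f x) / t) \<longlongrightarrow> M * norm u + 0) at_top"
    by (intro tendsto_intros tendsto_divide_0[OF tendsto_const] filterlim_at_top_imp_at_infinity
        filterlim_ident)
  moreover have "eventually (\<lambda>t. f y - f x \<le> M * norm u + (M * norm x - f x) / t) at_top"
    using eventually_ge_at_top bound by (rule eventually_mono)
  ultimately have "f y - f x \<le> M * norm u + 0"
    by (rule tendsto_lowerbound) simp
  then show ?thesis
    by (simp add: u_def)
qed simp

lemma lipschitz_on_if_convex_linear_growth:
  fixes f :: "'a::real_normed_vector \<Rightarrow> real"
  assumes "convex_on UNIV f" "M \<ge> 0"
    and "eventually (\<lambda>x. f x \<le> M * norm x) at_infinity"
  shows "M-lipschitz_on UNIV f"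
proof (rule lipschitz_onI)
  fix x y :: 'a
  show "dist (f x) (f y) \<le> M * dist x y"
    using convex_linear_growth_increment_le[OF assms, of x y]
      convex_linear_growth_increment_le[OF assms, of y x]
    by (auto simp: dist_norm norm_minus_commute abs_le_iff)
qed fact

theorem theorem4:
  fixes f :: "real ^ 'n \<Rightarrow> real"
  assumes "convex_on UNIV f"
  shows "let l = Limsup at_infinity (\<lambda>x. ereal (\<bar>f x\<bar> / norm x)) in
           ((\<exists>L. L-lipschitz_on UNIV f) \<longleftrightarrow> l < \<infinity>) \<and>
           ((\<exists>L. L-lipschitz_on UNIV f) \<longrightarrow> l = ereal (global_lipschitz_modulus f))"
proof -
  define l where "l = Limsup at_infinity (\<lambda>x. ereal (\<bar>f x\<bar> / norm x))"
  have "Limsup at_infinity (\<lambda>x::real^'n. 0 :: ereal) \<le> l"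
    unfolding l_def by (intro Limsup_mono always_eventually) auto
  then have l_nonneg: "0 \<le> l"
    by (simp add: Limsup_const trivial_limit_at_infinity)
  have lower: "l \<le> ereal L" if "L-lipschitz_on UNIV f" for L
    unfolding l_def using that by (rule Limsup_norm_quotient_le_lipschitz)
  have upper: "M-lipschitz_on UNIV f" if "l < ereal M" for M
  proof (rule lipschitz_on_if_convex_linear_growth[OF assms])
    show "0 \<le> M"
      using le_less_trans[OF l_nonneg that] by simp
    have "eventually (\<lambda>x. ereal (\<bar>f x\<bar> / norm x) < ereal M) at_infinity"
      using that unfolding l_def by (rule Limsup_lessD)
    moreover have "eventually (\<lambda>x::real^'n. norm x > 0) at_infinity"
      by (auto simp: eventually_at_infinity intro: exI[of _ 1])
    ultimately show "eventually (\<lambda>x. f x \<le> M * norm x) at_infinity"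
      by eventually_elim (simp add: field_simps)
  qed
  have "\<exists>L. L-lipschitz_on UNIV f" if "l < \<infinity>"
    using upper ereal_dense2[OF that] by blast
  moreover have "l < \<infinity>" if "L-lipschitz_on UNIV f" for L
    by (rule le_less_trans[OF lower[OF that]]) simp
  moreover have "l = ereal (global_lipschitz_modulus f)" if ex: "L-lipschitz_on UNIV f" for L
  proof -
    obtain r where r: "l = ereal r"
      using l_nonneg lower[OF ex] by (cases l) auto
    have "Inf {L. L-lipschitz_on UNIV f} = r"
    proof (rule antisym)
      have "bdd_below {L. L-lipschitz_on UNIV f}"
        using lower r by (intro bdd_belowI[of _ r]) auto
      then have "Inf {L. L-lipschitz_on UNIV f} \<le> M" if "r < M" for M
        using upper that r by (auto intro: cInf_lower)
      then show "Inf {L. L-lipschitz_on UNIV f} \<le> r"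
        by (rule dense_ge)
      show "r \<le> Inf {L. L-lipschitz_on UNIV f}"
        using lower r ex by (intro cInf_greatest) auto
    qed
    with r show ?thesis
      by (simp add: global_lipschitz_modulus_def)
  qed
  ultimately show ?thesis
    unfolding Let_def l_def[symmetric] by blast
qed

end
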